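(* Let $\mathsf{B}$ be a (counital) $C^*$-bialgebra of discrete type, that is, a $C^*$-bialgebra which as a $C^*$-algebra is a $c_0$-direct sum of (full) matrix algebras. Let $(\lambda_t)_{t\ge0}$ be a weakly continuous convolution semigroup of states on $\mathsf{B}$. Then $(\lambda_t)_{t\ge0}$ is norm-continuous.
   Context: $\otimes$ is the minimal (spatial) $C^*$-tensor product; $M(\mathsf{A})$ is the multiplier algebra of a $C^*$-algebra $\mathsf{A}$ with its strict topology. A linear map $T:\mathsf{A}\to M(\mathsf{C})$ (or $M(\mathsf{A})\to M(\mathsf{C})$) is strict if it is bounded and strictly continuous on bounded sets; a strict $T:\mathsf{A}\to M(\mathsf{C})$ has a unique strict extension $\widetilde{T}:M(\mathsf{A})\to M(\mathsf{C})$, and a composition $ST$ of strict maps $T:\mathsf{A}_1\to M(\mathsf{A}_2)$, $S:\mathsf{A}_2\to M(\mathsf{A}_3)$ means $\widetilde{S}\circ T$. A $C^*$-bialgebra is a $C^*$-algebra $\mathsf{B}$ with a nondegenerate $*$-homomorphism $\Delta:\mathsf{B}\to M(\mathsf{B}\otimes\mathsf{B})$ (coproduct) and a character $\epsilon:\mathsf{B}\to\mathbb{C}$ (counit) such that $(\mathrm{id}\otimes\Delta)\Delta=(\Delta\otimes\mathrm{id})\Delta$ and $(\mathrm{id}\otimes\epsilon)\Delta=\mathrm{id}=(\epsilon\otimes\mathrm{id})\Delta$. Convolution on $\mathsf{B}^*$ is $\lambda\star\mu=(\lambda\otimes\mu)\Delta$. A convolution semigroup of functionals on $\mathsf{B}$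 is a family $(\lambda_t)_{t\ge0}$ in $\mathsf{B}^*$ with $\lambda_0=\epsilon$ and $\lambda_{s+t}=\lambda_s\star\lambda_t$ for $s,t\ge0$; it is a convolution semigroup of states if every $\lambda_t$ is a state. It is weakly continuous if $\lim_{t\to0^+}\lambda_t(a)=\epsilon(a)$ for all $a\in\mathsf{B}$, and norm-continuous if $\lim_{t\to0^+}\|\lambda_t-\epsilon\|=0$. *)

theory Defs
  imports
    "HOL-Analysis.Analysis"
    "Jordan_Normal_Form.Schur_Decomposition"
begin

section \<open>\<open>C\<^sup>*\<close>-algebras\<close>

text \<open>Complex, not necessarily unital. The real structure of \<^class>\<open>banach\<close> is the restriction of
  the complex one.\<close>

class cstar_algebra = real_normed_algebra + banach +
  fixes scaleC :: "complex \<Rightarrow> 'a \<Rightarrow> 'a" (infixr "*\<^sub>C" 75)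
    and star :: "'a \<Rightarrow> 'a"
  assumes scaleC_add_right: "c *\<^sub>C (x + y) = c *\<^sub>C x + c *\<^sub>C y"
    and scaleC_add_left: "(c + d) *\<^sub>C x = c *\<^sub>C x + d *\<^sub>C x"
    and scaleC_scaleC: "c *\<^sub>C d *\<^sub>C x = (c * d) *\<^sub>C x"
    and scaleC_of_real: "complex_of_real r *\<^sub>C x = r *\<^sub>R x"
    and mult_scaleC_left: "(c *\<^sub>C x) * y = c *\<^sub>C (x * y)"
    and mult_scaleC_right: "x * (c *\<^sub>C y) = c *\<^sub>C (x * y)"
    and norm_scaleC: "norm (c *\<^sub>C x) = cmod c * norm x"
    and star_add: "star (x + y) = star x + star y"
    and star_scaleC: "star (c *\<^sub>C x) = cnj c *\<^sub>C star x"
    and star_mult: "star (x * y) = star y * star x"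
    and star_star: "star (star x) = x"
    and norm_star_mult: "norm (star x * x) = (norm x)\<^sup>2"

instantiation complex :: cstar_algebra
begin

definition "scaleC_complex = ((*) :: complex \<Rightarrow> complex \<Rightarrow> complex)"
definition "star_complex = cnj"

instance
  by standard (auto simp: scaleC_complex_def star_complex_def algebra_simps scaleR_conv_of_real
      norm_mult power2_eq_square)

end

definition bounded_clinear :: "('a::cstar_algebra \<Rightarrow> 'b::cstar_algebra) \<Rightarrow> bool" where
  "bounded_clinear f \<longleftrightarrow> bounded_linear f \<and> (\<forall>c x. f (c *\<^sub>C x) = c *\<^sub>C f x)"

definition star_hom :: "('a::cstar_algebra \<Rightarrow> 'b::cstar_algebra) \<Rightarrow> bool" where
  "star_hom f \<longleftrightarrow>
     (\<forall>x y. f (x + y) = f x + f y) \<and> (\<forall>c x. f (c *\<^sub>C x) = c *\<^sub>C f x) \<and>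
     (\<forall>x y. f (x * y) = f x * f y) \<and> (\<forall>x. f (star x) = star (f x))"

definition character :: "('a::cstar_algebra \<Rightarrow> complex) \<Rightarrow> bool" where
  "character f \<longleftrightarrow> star_hom f \<and> (\<exists>x. f x \<noteq> 0)"

text \<open>For a functional \<^term>\<open>f\<close>, \<^term>\<open>onorm f\<close> is the norm of \<open>f\<close> in the dual space.\<close>

definition state :: "('a::cstar_algebra \<Rightarrow> complex) \<Rightarrow> bool" where
  "state f \<longleftrightarrow> bounded_clinear f \<and> (\<forall>x. f (star x * x) \<in> \<real>\<^sub>\<ge>\<^sub>0) \<and> onorm f = 1"

lemma norm_star: "norm (star x) = norm (x :: 'a::cstar_algebra)"
proof -
  have le: "norm y \<le> norm (star y)" for y :: 'a
  proof (cases "norm y = 0")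
    case False
    have "norm y * norm y \<le> norm (star y) * norm y"
      using norm_star_mult[of y] norm_mult_ineq[of "star y" y] by (simp add: power2_eq_square)
    with False show ?thesis by simp
  qed simp
  from le[of x] le[of "star x"] show ?thesis by (simp add: star_star)
qed

lemma star_scaleR: "star (r *\<^sub>R x) = r *\<^sub>R star (x :: 'a::cstar_algebra)"
  by (metis complex_cnj_complex_of_real scaleC_of_real star_scaleC)

lemma bounded_linear_star: "bounded_linear (star :: 'a::cstar_algebra \<Rightarrow> 'a)"
  by (rule bounded_linear_intro[where K = 1]) (auto simp: star_add star_scaleR norm_star)

lemma bounded_linear_scaleC: "bounded_linear (\<lambda>x :: 'a::cstar_algebra. c *\<^sub>C x)"
proof (rule bounded_linear_intro[where K = "cmod c"])
  show "c *\<^sub>C (r *\<^sub>R x) = r *\<^sub>R (c *\<^sub>C x)" for r and x :: 'a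
    by (metis scaleC_of_real scaleC_scaleC mult.commute)
qed (auto simp: scaleC_add_right norm_scaleC)

lemma vector_space_scaleC: "vector_space ((*\<^sub>C) :: complex \<Rightarrow> 'a \<Rightarrow> 'a::cstar_algebra)"
  using scaleC_of_real[of 1]
  by unfold_locales (simp_all add: scaleC_add_right scaleC_add_left scaleC_scaleC)

lemma left_cancel: "x = y" if "\<And>a. a * x = a * y" for x y :: "'a::cstar_algebra"
proof -
  have "star (x - y) * (x - y) = 0" using that by (simp add: right_diff_distrib)
  then have "(norm (x - y))\<^sup>2 = 0" by (metis norm_star_mult norm_zero)
  then show ?thesis by simp
qed

lemma right_cancel: "x = y" if "\<And>a. x * a = y * a" for x y :: "'a::cstar_algebra"
proof -
  have "a * star x = a * star y" for a
    using that[of "star a"] by (metis star_mult star_star)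
  then have "star x = star y" by (rule left_cancel)
  then show ?thesis by (metis star_star)
qed


section \<open>Multiplier algebras\<close>

lift_definition scaleC_blinfun :: "complex \<Rightarrow> ('a::cstar_algebra \<Rightarrow>\<^sub>L 'a) \<Rightarrow> ('a \<Rightarrow>\<^sub>L 'a)" is
  "\<lambda>c f x. c *\<^sub>C f x"
  by (rule bounded_linear_compose[OF bounded_linear_scaleC])

text \<open>The adjoint of the double centraliser \<open>(L, R)\<close> is \<open>(sharp R, sharp L)\<close>.\<close>

lift_definition sharp :: "('a::cstar_algebra \<Rightarrow>\<^sub>L 'a) \<Rightarrow> ('a \<Rightarrow>\<^sub>L 'a)" is
  "\<lambda>f b. star (f (star b))"
  by (intro bounded_linear_compose[OF bounded_linear_star] bounded_linear_compose[OF _ bounded_linear_star])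

declare scaleC_blinfun.rep_eq [simp] sharp.rep_eq [simp]

lifting_forget blinfun.lifting

text \<open>The multiplier algebra as the algebra of double centralisers: \<open>L\<close> is left and \<open>R\<close> is
  right multiplication by the multiplier. Complex linearity of \<open>L\<close> and \<open>R\<close> follows from the
  defining identity (lemmas \<open>lmul_scaleC\<close> and \<open>rmul_scaleC\<close>).\<close>

typedef (overloaded) 'a multiplier =
  "{(L, R). \<forall>a b :: 'a::cstar_algebra. a * blinfun_apply L b = blinfun_apply R a * b}"
  by (rule exI[of _ "(0, 0)"]) simp

setup_lifting type_definition_multiplier

lift_definition lmul_blinfun :: "'a::cstar_algebra multiplier \<Rightarrow> 'a \<Rightarrow>\<^sub>L 'a" is fst .
lift_definition rmul_blinfun :: "'a::cstar_algebra multiplier \<Rightarrow> 'a \<Rightarrow>\<^sub>L 'a" is snd .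

text \<open>\<open>lmul m a\<close> is the product \<open>ma\<close>, and \<open>rmul m a\<close> is the product \<open>am\<close>.\<close>

abbreviation lmul :: "'a::cstar_algebra multiplier \<Rightarrow> 'a \<Rightarrow> 'a" where
  "lmul m \<equiv> blinfun_apply (lmul_blinfun m)"
abbreviation rmul :: "'a::cstar_algebra multiplier \<Rightarrow> 'a \<Rightarrow> 'a" where
  "rmul m \<equiv> blinfun_apply (rmul_blinfun m)"

lemma mult_lmul: "a * lmul m b = rmul m a * b"
  by transfer auto

lemma multiplier_eqI2:
  "lmul_blinfun m = lmul_blinfun n \<Longrightarrow> rmul_blinfun m = rmul_blinfun n \<Longrightarrow> m = n"
  by transfer (auto simp: prod_eq_iff)

lemma multiplier_eqI:
  assumes "\<And>b. lmul m b = lmul n b"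
  shows "m = n"
proof (rule multiplier_eqI2)
  show "lmul_blinfun m = lmul_blinfun n" by (rule blinfun_eqI) (rule assms)
  show "rmul_blinfun m = rmul_blinfun n"
    by (rule blinfun_eqI, rule right_cancel) (simp add: assms flip: mult_lmul)
qed

lemma lmul_mult: "lmul m (a * b) = lmul m a * b"
  by (rule left_cancel) (simp add: mult_lmul flip: mult.assoc)

lemma rmul_mult: "rmul m (a * b) = a * rmul m b"
  by (rule right_cancel) (simp add: mult.assoc flip: mult_lmul)

lemma lmul_scaleC: "lmul m (c *\<^sub>C b) = c *\<^sub>C lmul m b"
  by (rule left_cancel) (simp add: mult_lmul mult_scaleC_right)

lemma rmul_scaleC: "rmul m (c *\<^sub>C b) = c *\<^sub>C rmul m b"
  by (rule right_cancel) (simp add: mult_lmul[symmetric] mult_scaleC_left)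

lemma norm_mult_star: "norm (x * star x) = (norm (x :: 'a::cstar_algebra))\<^sup>2"
  using norm_star_mult[of "star x"] by (simp add: star_star norm_star)

lemma norm_rmul_blinfun: "norm (rmul_blinfun m) = norm (lmul_blinfun m)"
proof (rule antisym; rule norm_blinfun_bound)
  fix a
  have "(norm (rmul m a))\<^sup>2 = norm (a * lmul m (star (rmul m a)))"
    by (simp add: mult_lmul norm_mult_star)
  also have "\<dots> \<le> norm a * (norm (lmul_blinfun m) * norm (star (rmul m a)))"
    by (intro order_trans[OF norm_mult_ineq] mult_left_mono norm_blinfun norm_ge_zero)
  finally have "norm (rmul m a) * norm (rmul m a) \<le> (norm (lmul_blinfun m) * norm a) * norm (rmul m a)"
    by (simp add: norm_star power2_eq_square ac_simps)
  then show "norm (rmul m a) \<le> norm (lmul_blinfun m) * norm a"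
    by (cases "rmul m a = 0") (simp, metis mult_right_le_imp_le zero_less_norm_iff)
next
  fix a
  have "(norm (lmul m a))\<^sup>2 = norm (rmul m (star (lmul m a)) * a)"
    by (simp flip: mult_lmul add: norm_star_mult)
  also have "\<dots> \<le> (norm (rmul_blinfun m) * norm (star (lmul m a))) * norm a"
    by (intro order_trans[OF norm_mult_ineq] mult_right_mono norm_blinfun norm_ge_zero)
  finally have "norm (lmul m a) * norm (lmul m a) \<le> (norm (rmul_blinfun m) * norm a) * norm (lmul m a)"
    by (simp add: norm_star power2_eq_square ac_simps)
  then show "norm (lmul m a) \<le> norm (rmul_blinfun m) * norm a"
    by (cases "lmul m a = 0") (simp, metis mult_right_le_imp_le zero_less_norm_iff)
qed simp_all

lemma mult_sharp:
  assumes "\<And>a b :: 'a::cstar_algebra. a * L b = R a * b"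
  shows "a * star (R (star b)) = star (L (star a)) * b"
  by (metis assms star_mult star_star)

instantiation multiplier :: (cstar_algebra) real_normed_vector
begin

lift_definition zero_multiplier :: "'a multiplier" is "(0, 0)"
  by simp
lift_definition plus_multiplier :: "'a multiplier \<Rightarrow> 'a multiplier \<Rightarrow> 'a multiplier" is
  "\<lambda>(L, R) (L', R'). (L + L', R + R')"
  by (auto simp: blinfun.add_left distrib_left distrib_right)
lift_definition minus_multiplier :: "'a multiplier \<Rightarrow> 'a multiplier \<Rightarrow> 'a multiplier" is
  "\<lambda>(L, R) (L', R'). (L - L', R - R')"
  by (auto simp: blinfun.diff_left left_diff_distrib right_diff_distrib)
lift_definition uminus_multiplier :: "'a multiplier \<Rightarrow> 'a multiplier" is
  "\<lambda>(L, R). (- L, - R)"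
  by (auto simp: blinfun.minus_left)
lift_definition scaleR_multiplier :: "real \<Rightarrow> 'a multiplier \<Rightarrow> 'a multiplier" is
  "\<lambda>r (L, R). (r *\<^sub>R L, r *\<^sub>R R)"
  by (auto simp: blinfun.scaleR_left)
definition "norm_multiplier (m :: 'a multiplier) = norm (lmul_blinfun m)"
definition "dist_multiplier (m :: 'a multiplier) n = norm (m - n)"
definition "sgn_multiplier (m :: 'a multiplier) = scaleR (inverse (norm m)) m"
definition [code del]:
  "(uniformity :: ('a multiplier \<times> 'a multiplier) filter) =
     (INF e\<in>{0 <..}. principal {(x, y). dist x y < e})"
definition [code del]:
  "open_multiplier (S :: 'a multiplier set) =
     (\<forall>x\<in>S. \<forall>\<^sub>F (x', y) in uniformity. x' = x \<longrightarrow> y \<in> S)"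

lemma lmul_simps:
  "lmul_blinfun (0 :: 'a multiplier) = 0"
  "lmul_blinfun (m + n :: 'a multiplier) = lmul_blinfun m + lmul_blinfun n"
  "lmul_blinfun (m - n :: 'a multiplier) = lmul_blinfun m - lmul_blinfun n"
  "lmul_blinfun (- m :: 'a multiplier) = - lmul_blinfun m"
  "lmul_blinfun (r *\<^sub>R m :: 'a multiplier) = r *\<^sub>R lmul_blinfun m"
  by (transfer, force)+

lemma rmul_diff: "rmul_blinfun (m - n :: 'a multiplier) = rmul_blinfun m - rmul_blinfun n"
  by (transfer, force)

instance
proof
  fix m n p :: "'a multiplier" and r s :: real
  show "m + n + p = m + (n + p)" "m + n = n + m" "0 + m = m" "- m + m = 0" "m - n = m + - n"
    "r *\<^sub>R (m + n) = r *\<^sub>R m + r *\<^sub>R n" "(r + s) *\<^sub>R m = r *\<^sub>R m + s *\<^sub>R m"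
    "r *\<^sub>R s *\<^sub>R m = (r * s) *\<^sub>R m" "1 *\<^sub>R m = m"
    by (rule multiplier_eqI, simp add: lmul_simps blinfun.bilinear_simps algebra_simps)+
  show "dist m n = norm (m - n)" "sgn m = scaleR (inverse (norm m)) m"
    by (simp_all add: dist_multiplier_def sgn_multiplier_def)
  show "(uniformity :: ('a multiplier \<times> 'a multiplier) filter) =
     (INF e\<in>{0 <..}. principal {(x, y). dist x y < e})"
    by (rule uniformity_multiplier_def)
  show "open U = (\<forall>x\<in>U. \<forall>\<^sub>F (x', y) in uniformity. x' = x \<longrightarrow> y \<in> U)" for U :: "'a multiplier set"
    by (rule open_multiplier_def)
  show "(norm m = 0) = (m = 0)"
    by (auto simp: norm_multiplier_def lmul_simps intro!: multiplier_eqI)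
  show "norm (m + n) \<le> norm m + norm n"
    by (simp add: norm_multiplier_def lmul_simps norm_triangle_ineq)
  show "norm (r *\<^sub>R m) = \<bar>r\<bar> * norm m"
    by (simp add: norm_multiplier_def lmul_simps)
qed

end

instance multiplier :: (cstar_algebra) banach
proof
  fix X :: "nat \<Rightarrow> 'a multiplier"
  assume "Cauchy X"
  show "convergent X"
proof -
  have "Cauchy (\<lambda>i. lmul_blinfun (X i))" "Cauchy (\<lambda>i. rmul_blinfun (X i))"
    using \<open>Cauchy X\<close> by (auto simp: Cauchy_def dist_multiplier_def norm_multiplier_def dist_norm
        lmul_simps norm_rmul_blinfun simp flip: rmul_diff)
  then obtain L R where
    L: "(\<lambda>i. lmul_blinfun (X i)) \<longlonglongrightarrow> L" and R: "(\<lambda>i. rmul_blinfun (X i)) \<longlonglongrightarrow> R"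
    by (meson Cauchy_convergent convergentD)
  have "a * L b = R a * b" for a b
  proof (rule LIMSEQ_unique)
    show "(\<lambda>i. a * lmul (X i) b) \<longlonglongrightarrow> a * L b"
      by (intro tendsto_intros L)
    show "(\<lambda>i. a * lmul (X i) b) \<longlonglongrightarrow> R a * b"
      unfolding mult_lmul by (intro tendsto_intros R)
  qed
  then have "lmul_blinfun (Abs_multiplier (L, R)) = L"
    by (simp add: lmul_blinfun.rep_eq Abs_multiplier_inverse)
  with L have "X \<longlonglongrightarrow> Abs_multiplier (L, R)"
    by (simp add: tendsto_dist_iff[of X] tendsto_dist_iff[of "\<lambda>i. lmul_blinfun (X i)"]
        dist_multiplier_def norm_multiplier_def dist_norm lmul_simps)
  then show ?thesis by (rule convergentI)
qed
qed

instantiation multiplier :: (cstar_algebra) cstar_algebra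
begin

lift_definition scaleC_multiplier :: "complex \<Rightarrow> 'a multiplier \<Rightarrow> 'a multiplier" is
  "\<lambda>c (L, R). (scaleC_blinfun c L, scaleC_blinfun c R)"
  by (auto simp: mult_scaleC_left mult_scaleC_right)
lift_definition times_multiplier :: "'a multiplier \<Rightarrow> 'a multiplier \<Rightarrow> 'a multiplier" is
  "\<lambda>(L, R) (L', R'). (L o\<^sub>L L', R' o\<^sub>L R)"
  by auto
lift_definition star_multiplier :: "'a multiplier \<Rightarrow> 'a multiplier" is
  "\<lambda>(L, R). (sharp R, sharp L)"
  by (clarsimp simp: mult_sharp)

lemma lmul_simps2:
  "lmul_blinfun (c *\<^sub>C m :: 'a multiplier) = scaleC_blinfun c (lmul_blinfun m)"
  "lmul_blinfun (m * n :: 'a multiplier) = lmul_blinfun m o\<^sub>L lmul_blinfun n"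
  "lmul_blinfun (star m :: 'a multiplier) = sharp (rmul_blinfun m)"
  by (transfer, force)+

lemma rmul_star: "rmul_blinfun (star m :: 'a multiplier) = sharp (lmul_blinfun m)"
  by (transfer, force)

instance
proof
  fix m n p :: "'a multiplier" and r s :: real and c d :: complex
  show "m * n * p = m * (n * p)" "(m + n) * p = m * p + n * p" "m * (n + p) = m * n + m * p"
    "(r *\<^sub>R m) * n = r *\<^sub>R (m * n)" "m * (r *\<^sub>R n) = r *\<^sub>R (m * n)"
    by (rule multiplier_eqI, simp add: lmul_simps lmul_simps2 blinfun.bilinear_simps)+
  show "c *\<^sub>C (m + n) = c *\<^sub>C m + c *\<^sub>C n" "(c + d) *\<^sub>C m = c *\<^sub>C m + d *\<^sub>C m"
    "c *\<^sub>C d *\<^sub>C m = (c * d) *\<^sub>C m" "complex_of_real r *\<^sub>C m = r *\<^sub>R m"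
    "(c *\<^sub>C m) * n = c *\<^sub>C (m * n)" "m * (c *\<^sub>C n) = c *\<^sub>C (m * n)"
    by (rule multiplier_eqI, simp add: lmul_simps lmul_simps2 blinfun.bilinear_simps
        scaleC_add_right scaleC_add_left scaleC_scaleC scaleC_of_real lmul_scaleC)+
  show "norm (m * n) \<le> norm m * norm n"
    by (simp add: norm_multiplier_def lmul_simps lmul_simps2 norm_blinfun_compose)
  show norm_scaleC: "norm (c *\<^sub>C m) = cmod c * norm m" for c and m :: "'a multiplier"
  proof -
    have le: "norm (c *\<^sub>C m) \<le> cmod c * norm m" for c and m :: "'a multiplier"
      unfolding norm_multiplier_def lmul_simps lmul_simps2
      by (rule norm_blinfun_bound)
        (auto simp: norm_scaleC mult.assoc intro!: mult_left_mono norm_blinfun)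
    show ?thesis
    proof (cases "c = 0")
      case False
      have "m = inverse c *\<^sub>C c *\<^sub>C m"
        using False by (intro multiplier_eqI)
          (simp add: lmul_simps lmul_simps2 scaleC_scaleC scaleC_of_real[of 1, simplified])
      with le[of "inverse c" "c *\<^sub>C m"] have "norm m \<le> inverse (cmod c) * norm (c *\<^sub>C m)"
        by (simp add: norm_inverse)
      with False have "cmod c * norm m \<le> norm (c *\<^sub>C m)"
        by (simp add: field_simps)
      with le[of c m] show ?thesis by simp
    qed (use le[of 0 m] in \<open>auto simp: norm_multiplier_def\<close>)
  qed
  show "star (m + n) = star m + star n" "star (c *\<^sub>C m) = cnj c *\<^sub>C star m"
    "star (m * n) = star n * star m" "star (star m) = m"
    by (rule multiplier_eqI2; transfer;
        force intro!: blinfun_eqI simp: blinfun.add_left star_add star_scaleC star_star)+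
  show "norm (star m * m) = (norm m)\<^sup>2"
  proof (rule antisym)
    have "norm (star m * m) \<le> norm (star m) * norm m"
      by (simp add: norm_multiplier_def lmul_simps lmul_simps2 norm_blinfun_compose)
    also have "norm (star m) * norm m \<le> norm m * norm m"
    proof (rule mult_right_mono)
      show "norm (star m) \<le> norm m"
        unfolding norm_multiplier_def lmul_simps lmul_simps2
      proof (rule norm_blinfun_bound)
        fix b
        have "norm (rmul m (star b)) \<le> norm (rmul_blinfun m) * norm (star b)"
          by (rule norm_blinfun)
        then show "norm (blinfun_apply (sharp (rmul_blinfun m)) b) \<le> norm (lmul_blinfun m) * norm b"
          by (simp add: norm_star norm_rmul_blinfun)
      qed simp
    qed (simp add: norm_multiplier_def)
    finally show "norm (star m * m) \<le> (norm m)\<^sup>2"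
      by (simp add: power2_eq_square)
  next
    let ?K = "norm (star m * m)"
    have K: "0 \<le> ?K" by (simp add: norm_multiplier_def)
    have "(norm (lmul m b))\<^sup>2 \<le> ?K * (norm b)\<^sup>2" for b
    proof -
      have "star (lmul m b) * lmul m b = star b * lmul (star m * m) b"
        using mult_lmul[of "star b" "star m" "lmul m b"] by (simp add: lmul_simps lmul_simps2 rmul_star star_star)
      then have "(norm (lmul m b))\<^sup>2 = norm (star b * lmul (star m * m) b)"
        by (metis norm_star_mult)
      also have "\<dots> \<le> norm (star b) * norm (lmul (star m * m) b)"
        by (rule norm_mult_ineq)
      also have "\<dots> \<le> norm b * (?K * norm b)"
        unfolding norm_multiplier_def norm_star by (intro mult_left_mono norm_blinfun norm_ge_zero)
      finally show ?thesis by (simp add: power2_eq_square ac_simps)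
    qed
    then have "norm (lmul m b) \<le> sqrt ?K * norm b" for b
      using real_le_rsqrt[of "norm (lmul m b)" "?K * (norm b)\<^sup>2"] by (simp add: real_sqrt_mult)
    then have "norm m \<le> sqrt ?K"
      unfolding norm_multiplier_def[of m] by (intro norm_blinfun_bound) (auto simp: K)
    then show "(norm m)\<^sup>2 \<le> ?K"
      using K power_mono[of "norm m" "sqrt ?K" 2] by (simp add: norm_multiplier_def)
  qed
qed

end

lift_definition mult_of :: "'a::cstar_algebra \<Rightarrow> 'a multiplier" is
  "\<lambda>a. (blinfun_mult_right a, blinfun_mult_left a)"
  by (auto simp: mult.assoc)


text \<open>The weakest topology on \<open>M(A)\<close> that makes all maps \<open>m \<mapsto> ma\<close> and \<open>m \<mapsto> am\<close>
  (\<open>a \<in> A\<close>) continuous.\<close>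

definition strict_topology :: "'a::cstar_algebra multiplier topology" where
  "strict_topology = topology_generated_by
     ({{m. lmul m a \<in> U} | a U. open U} \<union> {{m. rmul m a \<in> U} | a U. open U})"

definition strict :: "('a::cstar_algebra \<Rightarrow> 'c::cstar_algebra multiplier) \<Rightarrow> bool" where
  "strict T \<longleftrightarrow> bounded_clinear T \<and>
     (\<forall>r. continuous_map
        (subtopology (pullback_topology UNIV mult_of strict_topology) (cball 0 r))
        strict_topology T)"

definition strict_on_multipliers ::
  "('a::cstar_algebra multiplier \<Rightarrow> 'c::cstar_algebra multiplier) \<Rightarrow> bool" where
  "strict_on_multipliers T \<longleftrightarrow> bounded_clinear T \<and>
     (\<forall>r. continuous_map (subtopology strict_topology (cball 0 r)) strict_topology T)"

definition strict_extension ::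
  "('a::cstar_algebra \<Rightarrow> 'c::cstar_algebra multiplier) \<Rightarrow> 'a multiplier \<Rightarrow> 'c multiplier" where
  "strict_extension T = (THE T'. strict_on_multipliers T' \<and> (\<forall>a. T' (mult_of a) = T a))"

definition strict_comp ::
  "('b::cstar_algebra \<Rightarrow> 'c::cstar_algebra multiplier) \<Rightarrow> ('a \<Rightarrow> 'b multiplier) \<Rightarrow> 'a \<Rightarrow> 'c multiplier"
  where "strict_comp S T = strict_extension S \<circ> T"

text \<open>For a \<open>*\<close>-homomorphism \<open>f : A \<rightarrow> M(C)\<close>, nondegeneracy says that the closed linear span of
  \<open>f(A)C\<close> is \<open>C\<close>. As \<open>f(A)C\<close> is closed under complex scaling, its real span is its complex
  span.\<close>

definition nondegenerate :: "('a::cstar_algebra \<Rightarrow> 'c::cstar_algebra multiplier) \<Rightarrow> bool" where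
  "nondegenerate f \<longleftrightarrow> closure (span {lmul (f a) c | a c. True}) = UNIV"


section \<open>Minimal tensor products\<close>

text \<open>Instead of fixing a construction of \<open>A \<otimes> C\<close>, we say what it means for a type, together with
  a map \<open>(a, c) \<mapsto> a \<otimes> c\<close>, to be the minimal tensor product of \<open>A\<close> and \<open>C\<close>. This determines
  it up to a unique isomorphism. As above, the real span of the elementary tensors is their
  complex span.\<close>

definition elementary_span :: "('a::cstar_algebra \<Rightarrow> 'c::cstar_algebra \<Rightarrow> 't::cstar_algebra) \<Rightarrow> 't set"
  where "elementary_span tens = span {tens a c | a c. True}"

text \<open>The elementary tensors multiply and are adjoined componentwise, and their span is a copy of
  the algebraic tensor product.\<close>

definition algebraic_tensor ::
  "('a::cstar_algebra \<Rightarrow> 'c::cstar_algebra \<Rightarrow> 't::cstar_algebra) \<Rightarrow> bool" where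
  "algebraic_tensor tens \<longleftrightarrow>
     (\<forall>a a' c. tens (a + a') c = tens a c + tens a' c) \<and>
     (\<forall>a c c'. tens a (c + c') = tens a c + tens a c') \<and>
     (\<forall>k a c. tens (k *\<^sub>C a) c = k *\<^sub>C tens a c) \<and>
     (\<forall>k a c. tens a (k *\<^sub>C c) = k *\<^sub>C tens a c) \<and>
     (\<forall>a a' c c'. tens a c * tens a' c' = tens (a * a') (c * c')) \<and>
     (\<forall>a c. star (tens a c) = tens (star a) (star c)) \<and>
     (\<forall>F f. finite F \<and> \<not> module.dependent (*\<^sub>C) F \<and> (\<Sum>a\<in>F. tens a (f a)) = 0 \<longrightarrow>
        (\<forall>a\<in>F. f a = 0))"

definition cstar_norm_on :: "'t::cstar_algebra set \<Rightarrow> ('t \<Rightarrow> real) \<Rightarrow> bool" where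
  "cstar_norm_on S N \<longleftrightarrow>
     (\<forall>x\<in>S. 0 \<le> N x) \<and> (\<forall>x\<in>S. N x = 0 \<longleftrightarrow> x = 0) \<and>
     (\<forall>x\<in>S. \<forall>y\<in>S. N (x + y) \<le> N x + N y) \<and> (\<forall>k. \<forall>x\<in>S. N (k *\<^sub>C x) = cmod k * N x) \<and>
     (\<forall>x\<in>S. \<forall>y\<in>S. N (x * y) \<le> N x * N y) \<and> (\<forall>x\<in>S. N (star x * x) = (N x)\<^sup>2)"

text \<open>The spatial norm is the least \<open>C\<^sup>*\<close>-norm on the algebraic tensor product.\<close>

definition minimal_tensor ::
  "('a::cstar_algebra \<Rightarrow> 'c::cstar_algebra \<Rightarrow> 't::cstar_algebra) \<Rightarrow> bool" where
  "minimal_tensor tens \<longleftrightarrow> algebraic_tensor tens \<and>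
     closure (elementary_span tens) = UNIV \<and>
     (\<forall>N. cstar_norm_on (elementary_span tens) N \<longrightarrow> (\<forall>x\<in>elementary_span tens. norm x \<le> N x))"

text \<open>The image of \<open>(m, n)\<close> under \<open>M(A) \<times> M(C) \<rightarrow> M(A \<otimes> C)\<close>.\<close>

definition multiplier_tensor ::
  "('a::cstar_algebra \<Rightarrow> 'c::cstar_algebra \<Rightarrow> 't::cstar_algebra) \<Rightarrow>
   'a multiplier \<Rightarrow> 'c multiplier \<Rightarrow> 't multiplier" where
  "multiplier_tensor tens m n =
     (THE k. \<forall>a c. lmul k (tens a c) = tens (lmul m a) (lmul n c))"

text \<open>For \<open>S : A \<rightarrow> M(C)\<close> and \<open>T : A' \<rightarrow> M(C')\<close>, the map \<open>S \<otimes> T : A \<otimes> A' \<rightarrow> M(C \<otimes> C')\<close>.\<close>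

definition tensor_map ::
  "('a1::cstar_algebra \<Rightarrow> 'a2::cstar_algebra \<Rightarrow> 'a::cstar_algebra) \<Rightarrow>
   ('c1::cstar_algebra \<Rightarrow> 'c2::cstar_algebra \<Rightarrow> 'c::cstar_algebra) \<Rightarrow>
   ('a1 \<Rightarrow> 'c1 multiplier) \<Rightarrow> ('a2 \<Rightarrow> 'c2 multiplier) \<Rightarrow> 'a \<Rightarrow> 'c multiplier" where
  "tensor_map tensA tensC S T =
     (THE V. bounded_clinear V \<and>
        (\<forall>a b. V (tensA a b) = multiplier_tensor tensC (S a) (T b)))"


section \<open>\<open>C\<^sup>*\<close>-bialgebras and convolution\<close>

text \<open>A functional \<open>f\<close> is regarded as the map \<open>mult_of \<circ> f\<close> into \<open>M(\<complex>) = \<complex>\<close>, and the scalar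
  corresponding to \<open>m \<in> M(\<complex>)\<close> is \<open>lmul m 1\<close>. The tensor products \<open>B \<otimes> \<complex> = B\<close>, \<open>\<complex> \<otimes> B = B\<close> and
  \<open>\<complex> \<otimes> \<complex> = \<complex>\<close> are all given by scalar multiplication.

  In the following, \<open>tens\<close> presents the tensor product \<open>B \<otimes> B\<close>; and \<open>tensl : (B \<otimes> B) \<times> B \<rightarrow> C\<close>
  and \<open>tensr : B \<times> (B \<otimes> B) \<rightarrow> C\<close> present the same algebra \<open>C\<close> as \<open>(B \<otimes> B) \<otimes> B\<close> and as
  \<open>B \<otimes> (B \<otimes> B)\<close>, compatibly with the associativity isomorphism.\<close>

locale cstar_bialgebra =
  fixes tens :: "'b::cstar_algebra \<Rightarrow> 'b \<Rightarrow> 't::cstar_algebra"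
    and tensl :: "'t \<Rightarrow> 'b \<Rightarrow> 'u::cstar_algebra"
    and tensr :: "'b \<Rightarrow> 't \<Rightarrow> 'u"
    and \<Delta> :: "'b \<Rightarrow> 't multiplier"
    and \<epsilon> :: "'b \<Rightarrow> complex"
  assumes tens: "minimal_tensor tens"
    and tensl: "minimal_tensor tensl"
    and tensr: "minimal_tensor tensr"
    and tens_assoc: "tensl (tens a b) c = tensr a (tens b c)"
    and coproduct_hom: "star_hom \<Delta>"
    and coproduct_nondegenerate: "nondegenerate \<Delta>"
    and counit_character: "character \<epsilon>"
    and coassociative:
      "strict_comp (tensor_map tens tensr mult_of \<Delta>) \<Delta> =
       strict_comp (tensor_map tens tensl \<Delta> mult_of) \<Delta>"
    and counit_right:
      "strict_comp (tensor_map tens (\<lambda>b c. c *\<^sub>C b) mult_of (mult_of \<circ> \<epsilon>)) \<Delta> = mult_of"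
    and counit_left:
      "strict_comp (tensor_map tens (*\<^sub>C) (mult_of \<circ> \<epsilon>) mult_of) \<Delta> = mult_of"

definition convolution ::
  "('b::cstar_algebra \<Rightarrow> 'b \<Rightarrow> 't::cstar_algebra) \<Rightarrow> ('b \<Rightarrow> 't multiplier) \<Rightarrow>
   ('b \<Rightarrow> complex) \<Rightarrow> ('b \<Rightarrow> complex) \<Rightarrow> 'b \<Rightarrow> complex" where
  "convolution tens \<Delta> f g =
     (\<lambda>b. lmul (strict_comp (tensor_map tens (*\<^sub>C) (mult_of \<circ> f) (mult_of \<circ> g)) \<Delta> b) 1)"

definition convolution_semigroup ::
  "('b::cstar_algebra \<Rightarrow> 'b \<Rightarrow> 't::cstar_algebra) \<Rightarrow> ('b \<Rightarrow> 't multiplier) \<Rightarrow> ('b \<Rightarrow> complex) \<Rightarrow>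
   (real \<Rightarrow> 'b \<Rightarrow> complex) \<Rightarrow> bool" where
  "convolution_semigroup tens \<Delta> \<epsilon> l \<longleftrightarrow>
     (\<forall>t\<ge>0. bounded_clinear (l t)) \<and> l 0 = \<epsilon> \<and>
     (\<forall>s\<ge>0. \<forall>t\<ge>0. l (s + t) = convolution tens \<Delta> (l s) (l t))"

definition convolution_semigroup_of_states ::
  "('b::cstar_algebra \<Rightarrow> 'b \<Rightarrow> 't::cstar_algebra) \<Rightarrow> ('b \<Rightarrow> 't multiplier) \<Rightarrow> ('b \<Rightarrow> complex) \<Rightarrow>
   (real \<Rightarrow> 'b \<Rightarrow> complex) \<Rightarrow> bool" where
  "convolution_semigroup_of_states tens \<Delta> \<epsilon> l \<longleftrightarrow>
     convolution_semigroup tens \<Delta> \<epsilon> l \<and> (\<forall>t\<ge>0. state (l t))"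

definition weakly_continuous ::
  "('b::cstar_algebra \<Rightarrow> complex) \<Rightarrow> (real \<Rightarrow> 'b \<Rightarrow> complex) \<Rightarrow> bool" where
  "weakly_continuous \<epsilon> l \<longleftrightarrow> (\<forall>a. ((\<lambda>t. l t a) \<longlongrightarrow> \<epsilon> a) (at_right 0))"

definition norm_continuous ::
  "('b::cstar_algebra \<Rightarrow> complex) \<Rightarrow> (real \<Rightarrow> 'b \<Rightarrow> complex) \<Rightarrow> bool" where
  "norm_continuous \<epsilon> l \<longleftrightarrow> ((\<lambda>t. onorm (\<lambda>a. l t a - \<epsilon> a)) \<longlongrightarrow> 0) (at_right 0)"


section \<open>\<open>c\<^sub>0\<close>-direct sums of matrix algebras\<close>

definition vec_norm :: "complex vec \<Rightarrow> real" where
  "vec_norm v = sqrt (\<Sum>i<dim_vec v. (cmod (vec_index v i))\<^sup>2)"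

definition mat_norm :: "complex mat \<Rightarrow> real" where
  "mat_norm A = (SUP v\<in>{v \<in> carrier_vec (dim_col A). vec_norm v \<le> 1}. vec_norm (A *\<^sub>v v))"

definition c0_matrix_sum :: "('i \<Rightarrow> nat) \<Rightarrow> ('i \<Rightarrow> complex mat) set" where
  "c0_matrix_sum n = {x. (\<forall>i. x i \<in> carrier_mat (n i) (n i)) \<and>
     (\<forall>e>0. finite {i. mat_norm (x i) \<ge> e})}"

text \<open>\<open>\<Phi>\<close> is an isomorphism of \<open>C\<^sup>*\<close>-algebras from \<open>'b\<close> onto the \<open>c\<^sub>0\<close>-direct sum of the full
  matrix algebras of sizes \<open>n i \<ge> 1\<close>, which carries the componentwise operations and the
  supremum norm.\<close>

definition c0_matrix_sum_iso ::
  "('i \<Rightarrow> nat) \<Rightarrow> ('b::cstar_algebra \<Rightarrow> 'i \<Rightarrow> complex mat) \<Rightarrow> bool" where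
  "c0_matrix_sum_iso n \<Phi> \<longleftrightarrow>
     (\<forall>i. 1 \<le> n i) \<and> bij_betw \<Phi> UNIV (c0_matrix_sum n) \<and>
     (\<forall>a b i. \<Phi> (a + b) i = \<Phi> a i + \<Phi> b i) \<and>
     (\<forall>c a i. \<Phi> (c *\<^sub>C a) i = c \<cdot>\<^sub>m \<Phi> a i) \<and>
     (\<forall>a b i. \<Phi> (a * b) i = \<Phi> a i * \<Phi> b i) \<and>
     (\<forall>a i. \<Phi> (star a) i = mat_adjoint (\<Phi> a i)) \<and>
     (\<forall>a. norm a = (SUP i. mat_norm (\<Phi> a i)))"

end

theory Submission
  imports Defs
begin

text \<open>A character \<open>\<epsilon>\<close> of a \<open>c\<^sub>0\<close>-sum of matrix algebras lives on a single block, which must be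
  one-dimensional; so there is \<open>p\<close> with \<open>\<epsilon> p = 1\<close> and \<open>p a = a p = \<epsilon> a p\<close>, and \<open>p\<close> is a
  central projection. If \<open>b\<close> is a contraction with \<open>\<epsilon> b = 0\<close>, then \<open>p + b\<close> is a contraction, so
  that \<open>\<lambda> p + \<bar>\<lambda> b\<bar> \<le> 1\<close> for every state \<open>\<lambda>\<close>. As \<open>a = \<epsilon> a p + (a - \<epsilon> a p)\<close>, the norm of
  \<open>\<lambda> - \<epsilon>\<close> is controlled by the single number \<open>1 - \<lambda> p\<close>, which tends to \<open>0\<close> along the semigroup
  by weak continuity.\<close>

section \<open>Characters supported by a central projection\<close>

lemma scaleC_one [simp]: "1 *\<^sub>C x = (x :: 'a::cstar_algebra)"
  using scaleC_of_real[of 1 x] by simp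

lemma scaleC_zero_left [simp]: "0 *\<^sub>C x = (0 :: 'a::cstar_algebra)"
  using scaleC_of_real[of 0 x] by simp

lemma star_homD:
  assumes "star_hom f"
  shows "f (x + y) = f x + f y" "f (c *\<^sub>C x) = c *\<^sub>C f x" "f (x * y) = f x * f y"
    "f (star x) = star (f x)" "f 0 = 0"
proof -
  show "f (x + y) = f x + f y" "f (c *\<^sub>C x) = c *\<^sub>C f x" "f (x * y) = f x * f y"
    "f (star x) = star (f x)"
    using assms by (auto simp: star_hom_def)
  have "f (0 + 0) = f 0 + f 0" using assms unfolding star_hom_def by blast
  then show "f 0 = 0" by simp
qed

lemma bounded_clinearD:
  assumes "bounded_clinear f"
  shows "bounded_linear f" "f (x + y) = f x + f y" "f (c *\<^sub>C x) = c *\<^sub>C f x"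
  using assms by (auto simp: bounded_clinear_def linear_simps)

text \<open>Makes \<open>p\<close> an idempotent spanning a one-dimensional two-sided ideal; for a
  \<open>star_hom\<close> \<open>\<epsilon>\<close> this ideal complements the kernel.\<close>

definition supports :: "'a::cstar_algebra \<Rightarrow> ('a \<Rightarrow> complex) \<Rightarrow> bool" where
  "supports p \<epsilon> \<longleftrightarrow> \<epsilon> p = 1 \<and> (\<forall>a. p * a = \<epsilon> a *\<^sub>C p \<and> a * p = \<epsilon> a *\<^sub>C p)"

text \<open>Taking \<open>a = star p\<close> in \<open>supports\<close> gives
  \<open>star p * p = p\<close>, whose left side is self-adjoint; the C*-identity then leaves 0 and
  1 as possible norms, and \<open>\<epsilon> p = 1\<close> excludes 0.\<close>

lemma supports_projection:
  assumes "star_hom \<epsilon>" and "supports p \<epsilon>"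
  shows "star p * p = p" "star p = p" "norm p = 1"
proof -
  have "\<epsilon> (star p) = 1"
    using assms star_homD(4)[OF assms(1), of p] by (simp add: supports_def star_complex_def)
  then show *: "star p * p = p"
    using assms(2) by (auto simp: supports_def)
  show "star p = p"
    by (metis * star_mult star_star)
  have "norm p * norm p = norm p"
    using norm_star_mult[of p] by (simp add: * power2_eq_square)
  moreover have "p \<noteq> 0"
    using assms star_homD(5)[OF assms(1)] by (auto simp: supports_def)
  ultimately show "norm p = 1" by simp
qed

text \<open>Repeated squaring: \<open>(p + b)\<^sup>* (p + b) = p + b\<^sup>* b\<close> has the same shape, and all norms of this
  shape are at most \<open>2\<close>.\<close>

lemma norm_support_plus_le_1:
  assumes "star_hom \<epsilon>" and "supports p \<epsilon>" and "\<epsilon> b = 0" and "norm b \<le> 1"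
  shows "norm (p + b) \<le> 1"
proof (rule ccontr)
  note p = supports_projection[OF assms(1,2)]
  have bound: "norm (p + c) ^ (2 ^ k) \<le> 2" if "\<epsilon> c = 0" "norm c \<le> 1" for c k
    using that
  proof (induction k arbitrary: c)
    case 0
    then show ?case using norm_triangle_ineq[of p c] by (simp add: p)
  next
    case (Suc k)
    \<comment> \<open>Hence the cross terms \<open>p * c\<close> and \<open>star c * p\<close>
      vanish, both being multiples of \<open>p\<close> by values of
      \<open>\<epsilon>\<close>.\<close>
    have "\<epsilon> (star c) = 0"
      using star_homD(4)[OF assms(1), of c] Suc.prems by (simp add: star_complex_def)
    then have "star (p + c) * (p + c) = p + star c * c"
      using assms(2) Suc.prems p(1)
      by (simp add: star_add p(2) distrib_left distrib_right supports_def
          star_homD(1)[OF assms(1)])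
    then have "(norm (p + c))\<^sup>2 = norm (p + star c * c)"
      by (metis norm_star_mult)
    moreover have "norm (p + star c * c) ^ (2 ^ k) \<le> 2"
    proof (rule Suc.IH)
      show "\<epsilon> (star c * c) = 0"
        using Suc.prems star_homD(3)[OF assms(1), of "star c" c] by simp
      show "norm (star c * c) \<le> 1"
        using Suc.prems by (simp add: norm_star_mult power_le_one)
    qed
    ultimately show ?case by (simp add: power_mult)
  qed
  assume "\<not> norm (p + b) \<le> 1"
  \<comment> \<open>Powers of a number above 1 pass 2; \<open>m \<le> 2 ^ m\<close> then moves to an
    exponent covered by \<open>bound\<close>.\<close>
  then obtain m where m: "2 < norm (p + b) ^ m"
    using real_arch_pow[of "norm (p + b)" 2] by auto
  also have "\<dots> \<le> norm (p + b) ^ (2 ^ m)"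
    using \<open>\<not> norm (p + b) \<le> 1\<close> by (intro power_increasing) (auto simp: less_imp_le)
  finally show False using bound[OF assms(3,4), of m] by simp
qed

text \<open>\<open>f p\<close> is real and nonnegative because \<open>p = star p * p\<close>. A
  change of phase keeps an element in the kernel of \<open>\<epsilon>\<close> and preserves its
  norm, so its value under \<open>f\<close> can be aligned with \<open>f p\<close> before the
  contraction bound is applied.\<close>

lemma state_kernel_bound:
  assumes "star_hom \<epsilon>" and "supports p \<epsilon>" and "state f" and "\<epsilon> b = 0"
  shows "cmod (f b) \<le> norm b * (1 - Re (f p))" and "f p = complex_of_real (Re (f p))"
    and "Re (f p) \<le> 1"
proof -
  note p = supports_projection[OF assms(1,2)]
  have f: "bounded_clinear f" and "onorm f = 1"
    using assms(3) by (auto simp: state_def)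
  note lin = bounded_clinearD[OF f]
  have le: "cmod (f x) \<le> norm x" for x
    using onorm[OF lin(1), of x] \<open>onorm f = 1\<close> by simp
  have "f (star p * p) \<in> \<real>\<^sub>\<ge>\<^sub>0"
    using assms(3) unfolding state_def by blast
  then obtain r where "f p = complex_of_real r" "0 \<le> r"
    by (metis p(1) nonneg_Reals_cases)
  then show fp: "f p = complex_of_real (Re (f p))" and "Re (f p) \<le> 1"
    using le[of p] p(3) by auto
  have *: "cmod (f c) \<le> 1 - Re (f p)" if "\<epsilon> c = 0" "norm c \<le> 1" for c
  proof -
    \<comment> \<open>The phase that makes \<open>f (z *\<^sub>C c)\<close> equal to
      \<open>cmod (f c)\<close>; if \<open>f c = 0\<close>, the value 1 keeps \<open>z\<close>
      unimodular.\<close>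
    define z where "z = (if f c = 0 then 1 else cnj (f c) / cmod (f c))"
    have z: "cmod z = 1" by (simp add: z_def norm_divide)
    have "f (z *\<^sub>C c) = cmod (f c)"
    proof (cases "f c = 0")
      case False
      then show ?thesis
        by (simp add: z_def lin scaleC_complex_def complex_norm_square[symmetric]
            power2_eq_square mult.commute)
    qed (simp add: z_def)
    then have "f (p + z *\<^sub>C c) = complex_of_real (Re (f p) + cmod (f c))"
      using fp by (simp add: lin)
    moreover have "norm (p + z *\<^sub>C c) \<le> 1"
      using that z assms(1)
      by (intro norm_support_plus_le_1[OF assms(1,2)])
        (simp_all add: star_homD(2) scaleC_complex_def norm_scaleC)
    ultimately have "cmod (complex_of_real (Re (f p) + cmod (f c))) \<le> 1"
      using le[of "p + z *\<^sub>C c"] by simp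
    then show ?thesis unfolding norm_of_real by simp
  qed
  show "cmod (f b) \<le> norm b * (1 - Re (f p))"
  proof (cases "b = 0")
    case True
    then show ?thesis using linear_0[OF bounded_linear.linear[OF lin(1)]] by simp
  next
    case False
    let ?k = "complex_of_real (inverse (norm b))"
    have "cmod (f (?k *\<^sub>C b)) \<le> 1 - Re (f p)"
      using False assms(4)
      by (intro *) (simp_all add: star_homD(2)[OF assms(1)] scaleC_complex_def norm_scaleC
          norm_inverse)
    then have "inverse (norm b) * cmod (f b) \<le> 1 - Re (f p)"
      by (simp add: lin scaleC_complex_def norm_mult norm_inverse)
    then show ?thesis using False by (simp add: field_simps)
  qed
qed

text \<open>The constant is 2 + 1: the kernel part \<open>b\<close> of \<open>a\<close> has norm at
  most \<open>2 * norm a\<close>, and the multiple of \<open>p\<close> contributes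
  \<open>\<epsilon> a * (f p - 1)\<close> with
  \<open>cmod (\<epsilon> a) \<le> norm a\<close>.\<close>

lemma onorm_state_diff_le:
  assumes "star_hom \<epsilon>" and "supports p \<epsilon>" and "state f"
  shows "onorm (\<lambda>a. f a - \<epsilon> a) \<le> 3 * cmod (f p - 1)"
proof (rule onorm_bound)
  show "0 \<le> 3 * cmod (f p - 1)" by simp
next
  fix a
  note p = supports_projection[OF assms(1,2)]
  define b where "b = a + (- \<epsilon> a) *\<^sub>C p"
  have \<epsilon>b: "\<epsilon> b = 0"
    using assms(2)
    by (simp add: b_def star_homD(1,2)[OF assms(1)] scaleC_complex_def supports_def)
  have "norm (\<epsilon> a *\<^sub>C p) = norm (a * p)"
    using assms(2) by (simp add: supports_def)
  also have "\<dots> \<le> norm a"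
    using norm_mult_ineq[of a p] by (simp add: p)
  finally have \<epsilon>a: "cmod (\<epsilon> a) \<le> norm a" by (simp add: norm_scaleC p)
  then have "norm b \<le> 2 * norm a"
    using norm_triangle_ineq[of a "(- \<epsilon> a) *\<^sub>C p"] by (simp add: b_def norm_scaleC p)
  note k = state_kernel_bound[OF assms \<epsilon>b]
  define d where "d = cmod (f p - 1)"
  \<comment> \<open>As \<open>f p\<close> is real and at most 1, \<open>d\<close> is exactly the
    factor in the kernel bound.\<close>
  have "f p - 1 = complex_of_real (Re (f p) - 1)"
    by (subst k(2)) simp
  then have d: "d = 1 - Re (f p)"
    unfolding d_def using k(3) by (simp only: norm_of_real)
  have "f b = f a - \<epsilon> a * f p"
    using assms(3) by (simp add: b_def state_def bounded_clinearD scaleC_complex_def)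
  then have "f a - \<epsilon> a = f b + \<epsilon> a * (f p - 1)"
    by (simp add: algebra_simps)
  then have "cmod (f a - \<epsilon> a) \<le> cmod (f b) + cmod (\<epsilon> a) * d"
    by (metis norm_triangle_ineq norm_mult d_def)
  also have "\<dots> \<le> norm b * d + norm a * d"
    using k(1) \<epsilon>a k(3) d by (intro add_mono mult_right_mono) auto
  also have "\<dots> \<le> 2 * norm a * d + norm a * d"
    using \<open>norm b \<le> 2 * norm a\<close> k(3) d by (intro add_mono mult_right_mono) auto
  finally show "norm (f a - \<epsilon> a) \<le> 3 * cmod (f p - 1) * norm a"
    by (simp add: d_def[symmetric] algebra_simps)
qed

section \<open>Characters of a sum of matrix algebras\<close>

lemma mat_norm_zero: "mat_norm (0\<^sub>m m k) = 0"
proof -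
  have *: "vec_norm (0\<^sub>m m k *\<^sub>v v) = 0" if "v \<in> carrier_vec k" for v
    using that by (simp add: vec_norm_def)
  \<comment> \<open>The unit ball is nonempty, so the supremum is over \<open>{0}\<close> and not
    over the empty set.\<close>
  have "0\<^sub>v k \<in> {v \<in> carrier_vec k. vec_norm v \<le> 1}"
    by (simp add: vec_norm_def)
  then have "(\<lambda>v. vec_norm (0\<^sub>m m k *\<^sub>v v)) ` {v \<in> carrier_vec k. vec_norm v \<le> 1} = {0}"
    using * by (metis (no_types, lifting) image_cong image_constant mem_Collect_eq)
  then show ?thesis
    unfolding mat_norm_def by simp
qed

text \<open>Meaningful for \<open>A\<close> of size \<open>n i\<close>: otherwise the family lies
  outside \<open>c0_matrix_sum n\<close>, and \<open>inv_into\<close> is unspecified there.\<close>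

definition block_embed ::
  "('i \<Rightarrow> nat) \<Rightarrow> ('b \<Rightarrow> 'i \<Rightarrow> complex mat) \<Rightarrow> 'i \<Rightarrow> complex mat \<Rightarrow> 'b" where
  "block_embed n \<Phi> i A = inv_into UNIV \<Phi> (\<lambda>j. if j = i then A else 0\<^sub>m (n j) (n j))"

context
  fixes n :: "'i \<Rightarrow> nat" and \<Phi> :: "'b::cstar_algebra \<Rightarrow> 'i \<Rightarrow> complex mat"
  assumes iso: "c0_matrix_sum_iso n \<Phi>"
begin

lemma c0_iso_simps:
  "\<Phi> (a + b) i = \<Phi> a i + \<Phi> b i" "\<Phi> (c *\<^sub>C a) i = c \<cdot>\<^sub>m \<Phi> a i" "\<Phi> (a * b) i = \<Phi> a i * \<Phi> b i"
  using iso by (auto simp: c0_matrix_sum_iso_def)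

lemma c0_iso_carrier: "\<Phi> a i \<in> carrier_mat (n i) (n i)"
  using iso by (fastforce simp: c0_matrix_sum_iso_def c0_matrix_sum_def dest: bij_betwE)

lemma c0_iso_eqI:
  assumes "\<And>i. \<Phi> a i = \<Phi> b i"
  shows "a = b"
proof -
  have "inj \<Phi>" using iso by (simp add: c0_matrix_sum_iso_def bij_betw_def)
  then show ?thesis using assms by (metis ext injD)
qed

lemma c0_iso_inv: "x \<in> c0_matrix_sum n \<Longrightarrow> \<Phi> (inv_into UNIV \<Phi> x) = x"
  using iso unfolding c0_matrix_sum_iso_def by (metis bij_betw_inv_into_right)

lemma block_embed:
  assumes "A \<in> carrier_mat (n i) (n i)"
  shows "\<Phi> (block_embed n \<Phi> i A) j = (if j = i then A else 0\<^sub>m (n j) (n j))"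
proof -
  have "(\<lambda>j. if j = i then A else 0\<^sub>m (n j) (n j)) \<in> c0_matrix_sum n"
    using assms
    by (auto simp: c0_matrix_sum_def mat_norm_zero intro: finite_subset[of _ "{i}"])
  then show ?thesis by (simp add: block_embed_def c0_iso_inv)
qed

lemma block_embed_add:
  assumes "A \<in> carrier_mat (n i) (n i)" "B \<in> carrier_mat (n i) (n i)"
  shows "block_embed n \<Phi> i (A + B) = block_embed n \<Phi> i A + block_embed n \<Phi> i B"
  using assms by (intro c0_iso_eqI) (simp add: c0_iso_simps block_embed)

lemma block_embed_mult:
  assumes "A \<in> carrier_mat (n i) (n i)" "B \<in> carrier_mat (n i) (n i)"
  shows "block_embed n \<Phi> i (A * B) = block_embed n \<Phi> i A * block_embed n \<Phi> i B"
  using assms by (intro c0_iso_eqI) (simp add: c0_iso_simps block_embed)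

lemma block_embed_zero: "block_embed n \<Phi> i (0\<^sub>m (n i) (n i)) = 0"
  using block_embed_add[of "0\<^sub>m (n i) (n i)" i "0\<^sub>m (n i) (n i)"] by simp

text \<open>The embedded block identity is central and cuts out its block. Extracting a block thus
  becomes a product, on which a character is multiplicative.\<close>

lemma block_embed_component:
  "block_embed n \<Phi> i (\<Phi> a i) = block_embed n \<Phi> i (1\<^sub>m (n i)) * a"
  "block_embed n \<Phi> i (\<Phi> a i) = a * block_embed n \<Phi> i (1\<^sub>m (n i))"
  by (intro c0_iso_eqI, simp add: c0_iso_simps block_embed c0_iso_carrier
      left_mult_one_mat[OF c0_iso_carrier] left_mult_zero_mat[OF c0_iso_carrier]
      right_mult_one_mat[OF c0_iso_carrier] right_mult_zero_mat[OF c0_iso_carrier])+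

lemma norm_c0_le:
  assumes "\<And>i. mat_norm (\<Phi> a i) \<le> d"
  shows "norm a \<le> d"
proof -
  have "norm a = (SUP i. mat_norm (\<Phi> a i))"
    using iso by (simp add: c0_matrix_sum_iso_def)
  also have "\<dots> \<le> d" using assms by (intro cSUP_least) auto
  finally show ?thesis .
qed

text \<open>Elements with finitely many nonzero blocks are dense, so a continuous character does not
  vanish on all of them.\<close>

lemma character_block:
  fixes \<epsilon> :: "'b \<Rightarrow> complex"
  assumes "star_hom \<epsilon>" and "bounded_linear \<epsilon>" and "\<epsilon> x \<noteq> 0"
  obtains i where "\<epsilon> (block_embed n \<Phi> i (1\<^sub>m (n i))) = 1"
proof -
  note hom = star_homD[OF assms(1)]
  have "\<exists>i. \<epsilon> (block_embed n \<Phi> i (1\<^sub>m (n i))) \<noteq> 0"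
  proof (rule ccontr)
    assume "\<not> ?thesis"
    then have zero: "\<epsilon> (block_embed n \<Phi> i (\<Phi> a i)) = 0" for i a
      by (simp add: block_embed_component(1) hom)
    \<comment> \<open>Subtracting embedded blocks one at a time leaves \<open>\<epsilon>\<close>
      unchanged, so finitely many blocks of \<open>x\<close> can be cleared.\<close>
    have kill: "\<exists>y. \<epsilon> y = \<epsilon> x \<and> (\<forall>i. \<Phi> y i = (if i \<in> F then 0\<^sub>m (n i) (n i) else \<Phi> x i))"
      if "finite F" for F
      using that
    proof (induction F)
      case (insert i F)
      then obtain y where y: "\<epsilon> y = \<epsilon> x"
        "\<And>i. \<Phi> y i = (if i \<in> F then 0\<^sub>m (n i) (n i) else \<Phi> x i)"
        by blast
      let ?y = "y + (-1) *\<^sub>C block_embed n \<Phi> i (\<Phi> x i)"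
      have "\<epsilon> ?y = \<epsilon> x"
        by (simp only: hom zero y scaleC_complex_def) simp
      moreover have "\<Phi> ?y j = (if j \<in> insert i F then 0\<^sub>m (n j) (n j) else \<Phi> x j)" for j
        using carrier_matD[OF c0_iso_carrier[of x i]] insert.hyps
        by (auto simp: c0_iso_simps block_embed c0_iso_carrier y intro!: eq_matI)
      ultimately show ?case by blast
    qed auto
    obtain K where K: "0 < K" "\<And>a. cmod (\<epsilon> a) \<le> norm a * K"
      using bounded_linear.pos_bounded[OF assms(2)] by auto
    \<comment> \<open>Chosen so that \<open>d * K\<close> is half of
      \<open>cmod (\<epsilon> x)\<close>, too small for the value of \<open>\<epsilon>\<close> at
      what remains of \<open>x\<close>.\<close>
    define d where "d = cmod (\<epsilon> x) / (2 * K)"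
    have "d > 0" using K assms(3) by (simp add: d_def)
    have "\<Phi> x \<in> c0_matrix_sum n"
      using iso by (auto simp: c0_matrix_sum_iso_def bij_betw_def)
    with \<open>d > 0\<close> have "finite {i. d \<le> mat_norm (\<Phi> x i)}"
      by (simp add: c0_matrix_sum_def)
    then obtain y where y: "\<epsilon> y = \<epsilon> x"
      "\<And>i. \<Phi> y i = (if d \<le> mat_norm (\<Phi> x i) then 0\<^sub>m (n i) (n i) else \<Phi> x i)"
      using kill[of "{i. d \<le> mat_norm (\<Phi> x i)}"] by auto
    have "norm y \<le> d"
      using \<open>d > 0\<close> by (intro norm_c0_le) (auto simp: y mat_norm_zero)
    then have "cmod (\<epsilon> x) \<le> d * K"
      using K(2)[of y] K(1) y(1) by (metis less_imp_le mult_right_mono order_trans)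
    then show False using K(1) assms(3) by (simp add: d_def)
  qed
  then obtain i where i: "\<epsilon> (block_embed n \<Phi> i (1\<^sub>m (n i))) \<noteq> 0" by blast
  \<comment> \<open>The value at an idempotent is 0 or 1.\<close>
  have "\<epsilon> (block_embed n \<Phi> i (1\<^sub>m (n i) * 1\<^sub>m (n i))) = (\<epsilon> (block_embed n \<Phi> i (1\<^sub>m (n i))))\<^sup>2"
    by (subst block_embed_mult) (simp_all add: hom power2_eq_square)
  with i that show thesis by (simp add: power2_eq_square)
qed

text \<open>Off-diagonal matrix units are nilpotent, and they generate the matrix algebra if its size is
  at least \<open>2\<close>.\<close>

lemma character_block_size:
  fixes \<epsilon> :: "'b \<Rightarrow> complex"
  assumes "star_hom \<epsilon>" and "\<epsilon> (block_embed n \<Phi> i (1\<^sub>m (n i))) = 1"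
  shows "n i = 1"
proof (rule ccontr)
  note hom = star_homD[OF assms(1)]
  let ?E = "\<lambda>j k. mat (n i) (n i) (\<lambda>(r, s). if r = j \<and> s = k then 1 else 0 :: complex)"
  let ?f = "\<lambda>A. \<epsilon> (block_embed n \<Phi> i A)"
  have mult: "?E j k * ?E k' m = (if k = k' then ?E j m else 0\<^sub>m (n i) (n i))"
    if "k < n i" for j k k' m
    using that
    by (auto intro!: eq_matI simp: scalar_prod_def if_distrib[of "\<lambda>x. x * _"] sum.delta'
        cong: if_cong)
  assume "n i \<noteq> 1"
  have diag: "?f (?E j j) = 0" if j: "j < n i" for j
  proof -
    obtain k where k: "k < n i" "k \<noteq> j"
      using \<open>n i \<noteq> 1\<close> j by (metis less_one linorder_neqE_nat not_less0 One_nat_def Suc_lessI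
          less_Suc_eq_0_disj neq0_conv)
    have "?f (?E j k) * ?f (?E j k) = ?f (?E j k * ?E j k)"
      by (subst block_embed_mult) (simp_all add: hom)
    also have "\<dots> = 0"
      using k by (simp add: mult block_embed_zero hom)
    finally have "?f (?E j k) = 0" by simp
    have "?f (?E j j) = ?f (?E j k * ?E k j)"
      using k by (simp add: mult)
    also have "\<dots> = ?f (?E j k) * ?f (?E k j)"
      by (subst block_embed_mult) (simp_all add: hom)
    finally show ?thesis using \<open>?f (?E j k) = 0\<close> by simp
  qed
  \<comment> \<open>The sum of the first \<open>m\<close> diagonal units, running from the zero
    matrix to the identity.\<close>
  let ?D = "\<lambda>m. mat (n i) (n i) (\<lambda>(r, s). if r = s \<and> r < m then 1 else 0 :: complex)"
  have "?f (?D m) = 0" if "m \<le> n i" for m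
    using that
  proof (induction m)
    case 0
    have "?D 0 = 0\<^sub>m (n i) (n i)" by (auto intro!: eq_matI)
    then show ?case by (simp only: block_embed_zero hom)
  next
    case (Suc m)
    have "?D (Suc m) = ?D m + ?E m m" by (auto intro!: eq_matI)
    then have "?f (?D (Suc m)) = ?f (?D m) + ?f (?E m m)"
      by (simp add: block_embed_add hom)
    then show ?case using Suc diag[of m] by simp
  qed
  from this[of "n i"] have "?f (?D (n i)) = 0" by simp
  moreover have "?D (n i) = 1\<^sub>m (n i)" by (auto intro!: eq_matI)
  ultimately show False using assms(2) by simp
qed

text \<open>Matrices in a block of size 1 are scalars, so multiplying \<open>a\<close> by the block
  identity \<open>p\<close> gives \<open>c *\<^sub>C p\<close>; applying \<open>\<epsilon>\<close>
  identifies \<open>c\<close> as \<open>\<epsilon> a\<close>.\<close>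

lemma character_supported:
  fixes \<epsilon> :: "'b \<Rightarrow> complex"
  assumes "character \<epsilon>" and "bounded_linear \<epsilon>"
  obtains p where "supports p \<epsilon>"
proof -
  have hom: "star_hom \<epsilon>" and "\<exists>x. \<epsilon> x \<noteq> 0"
    using assms(1) by (auto simp: character_def)
  then obtain i where i: "\<epsilon> (block_embed n \<Phi> i (1\<^sub>m (n i))) = 1"
    using character_block[OF hom assms(2)] by metis
  have n: "n i = 1" by (rule character_block_size[OF hom i])
  define p where "p = block_embed n \<Phi> i (1\<^sub>m (n i))"
  have "p * a = \<epsilon> a *\<^sub>C p \<and> a * p = \<epsilon> a *\<^sub>C p" for a
  proof -
    define c where "c = \<Phi> a i $$ (0, 0)"
    have A: "\<Phi> a i = c \<cdot>\<^sub>m 1\<^sub>m (n i)"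
      using c0_iso_carrier[of a i] by (auto intro!: eq_matI simp: n c_def)
    have *: "block_embed n \<Phi> i (\<Phi> a i) = c *\<^sub>C p"
      by (rule c0_iso_eqI) (auto simp: A p_def c0_iso_simps block_embed)
    have pa: "p * a = c *\<^sub>C p" "a * p = c *\<^sub>C p"
      unfolding p_def using * by (simp_all add: block_embed_component[symmetric] p_def)
    have "\<epsilon> p * \<epsilon> a = c * \<epsilon> p"
      using arg_cong[OF pa(1), of \<epsilon>] by (simp add: star_homD(2,3)[OF hom] scaleC_complex_def)
    then have "\<epsilon> a = c" using i by (simp add: p_def)
    with pa show ?thesis by simp
  qed
  with i that[of p] show thesis by (simp add: supports_def p_def)
qed

end

section \<open>Norm continuity from convergence at the supporting projection\<close>

theorem theorem4p2:
  fixes tens :: "'b::cstar_algebra \<Rightarrow> 'b \<Rightarrow> 't::cstar_algebra"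
    and tensl :: "'t \<Rightarrow> 'b \<Rightarrow> 'u::cstar_algebra"
    and tensr :: "'b \<Rightarrow> 't \<Rightarrow> 'u"
    and \<Delta> :: "'b \<Rightarrow> 't multiplier"
    and \<epsilon> :: "'b \<Rightarrow> complex"
    and n :: "'i \<Rightarrow> nat"
    and \<Phi> :: "'b \<Rightarrow> 'i \<Rightarrow> complex mat"
    and l :: "real \<Rightarrow> 'b \<Rightarrow> complex"
  assumes "cstar_bialgebra tens tensl tensr \<Delta> \<epsilon>"
    and "c0_matrix_sum_iso n \<Phi>"
    and "convolution_semigroup_of_states tens \<Delta> \<epsilon> l"
    and "weakly_continuous \<epsilon> l"
  shows "norm_continuous \<epsilon> l"
proof -
  have char: "character \<epsilon>"
    using assms(1) by (rule cstar_bialgebra.counit_character)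
  then have hom: "star_hom \<epsilon>" by (simp add: character_def)
  have states: "state (l t)" if "0 \<le> t" for t
    using assms(3) that by (simp add: convolution_semigroup_of_states_def)
  have "l 0 = \<epsilon>"
    using assms(3) by (simp add: convolution_semigroup_of_states_def convolution_semigroup_def)
  \<comment> \<open>The counit is itself the state at time 0, hence bounded.\<close>
  then have bdd: "bounded_linear \<epsilon>"
    using states[of 0] by (simp add: state_def bounded_clinear_def)
  obtain p where p: "supports p \<epsilon>"
    using character_supported[OF assms(2) char bdd] .
  \<comment> \<open>Weak continuity is evaluated at the single element \<open>p\<close>.\<close>
  have "((\<lambda>t. l t p) \<longlongrightarrow> 1) (at_right 0)"
    using assms(4) p by (metis weakly_continuous_def supports_def)
  then have "((\<lambda>t. 3 * cmod (l t p - 1)) \<longlongrightarrow> 3 * cmod (1 - 1)) (at_right 0)"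
    by (intro tendsto_intros)
  then have lim: "((\<lambda>t. 3 * cmod (l t p - 1)) \<longlongrightarrow> 0) (at_right 0)" by simp
  show ?thesis
    unfolding norm_continuous_def
  proof (rule real_tendsto_sandwich[OF _ _ tendsto_const lim])
    have bl: "bounded_linear (\<lambda>a. l t a - \<epsilon> a)" if "0 \<le> t" for t
      using states[OF that] bdd
      by (intro bounded_linear_sub) (auto simp: state_def bounded_clinear_def)
    show "\<forall>\<^sub>F t in at_right 0. 0 \<le> onorm (\<lambda>a. l t a - \<epsilon> a)"
      by (rule eventually_at_right_less[THEN eventually_mono]) (simp add: bl onorm_pos_le)
    show "\<forall>\<^sub>F t in at_right 0. onorm (\<lambda>a. l t a - \<epsilon> a) \<le> 3 * cmod (l t p - 1)"
      by (rule eventually_at_right_less[THEN eventually_mono])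
        (intro onorm_state_diff_le[OF hom p] states less_imp_le)
  qed
qed

end
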